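(* Let $M$ be a finitely generated $A_n(K)$-module with a system of generators $f_1,\dots,f_m$, and for $r,s\in\mathbf Z$ let $M_{rs}=\sum_{i=1}^m W_{rs}f_i$. Then there exists a numerical polynomial $\phi_M(t_1,t_2)$ in two variables such that (i) $\phi_M(r,s)=\dim_KM_{rs}$ for all sufficiently large $(r,s)\in\mathbf Z^2$ (i.e. there exist $r_0,s_0$ such that this holds for all $r\ge r_0$, $s\ge s_0$); (ii) $\deg_{t_1}\phi_M\le n$ and $\deg_{t_2}\phi_M\le n$, so that $\deg\phi_M\le 2n$ and $\phi_M$ can be written as $$\phi_M(t_1,t_2)=\sum_{i=0}^n\sum_{j=0}^n a_{ij}\binom{t_1+i}{i}\binom{t_2+j}{j}$$ with $a_{ij}\in\mathbf Z$ for all $i,j$.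
   Context: $K$ is a field of characteristic zero and $A_n(K)$ is the Weyl algebra generated over $K$ by $x_1,\dots,x_n,\partial_1,\dots,\partial_n$, all pairs commuting except $\partial_ix_i=x_i\partial_i+1$; the monomials $x^\alpha\partial^\beta$ ($\alpha,\beta\in\mathbf N^n$) form a $K$-basis. For $r,s\in\mathbf N$, $W_{rs}$ is the $K$-span of the monomials $x^\alpha\partial^\beta$ with $|\alpha|\le r$ and $|\beta|\le s$; $W_{rs}=0$ if $r<0$ or $s<0$. A polynomial $f(t_1,t_2)\in\mathbf Q[t_1,t_2]$ is numerical if $f(r,s)\in\mathbf Z$ for all sufficiently large integers $r,s$. $\binom{t}{k}=t(t-1)\cdots(t-k+1)/k!$, $\binom t0=1$. *)

theory Defs
  imports Complex_Main
begin

text \<open>A left module over the Weyl algebra A_n(K) is encoded by its underlying K-vector space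
  (scalar multiplication scale) together with the actions X i, D i (i < n) of the generators
  x_(i+1) and partial_(i+1), which are K-linear and satisfy the defining relations of A_n(K).\<close>

definition weyl_module ::
  "('k::field \<Rightarrow> 'v::ab_group_add \<Rightarrow> 'v) \<Rightarrow> nat \<Rightarrow> (nat \<Rightarrow> 'v \<Rightarrow> 'v) \<Rightarrow> (nat \<Rightarrow> 'v \<Rightarrow> 'v) \<Rightarrow> bool"
  where "weyl_module scale n X D \<longleftrightarrow>
     Vector_Spaces.vector_space scale \<and>
     (\<forall>i<n. Vector_Spaces.linear scale scale (X i) \<and> Vector_Spaces.linear scale scale (D i)) \<and>
     (\<forall>i<n. \<forall>j<n. \<forall>v. X i (X j v) = X j (X i v)) \<and>
     (\<forall>i<n. \<forall>j<n. \<forall>v. D i (D j v) = D j (D i v)) \<and>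
     (\<forall>i<n. \<forall>j<n. i \<noteq> j \<longrightarrow> (\<forall>v. D i (X j v) = X j (D i v))) \<and>
     (\<forall>i<n. \<forall>v. D i (X i v) = X i (D i v) + v)"

definition mon_act :: "nat \<Rightarrow> (nat \<Rightarrow> 'v \<Rightarrow> 'v) \<Rightarrow> (nat \<Rightarrow> nat) \<Rightarrow> 'v \<Rightarrow> 'v"
  where "mon_act n Y \<alpha> = foldr (\<lambda>i g. (Y i ^^ \<alpha> i) \<circ> g) [0..<n] id"

definition weyl_generates ::
  "('k::field \<Rightarrow> 'v::ab_group_add \<Rightarrow> 'v) \<Rightarrow> nat \<Rightarrow> (nat \<Rightarrow> 'v \<Rightarrow> 'v) \<Rightarrow> (nat \<Rightarrow> 'v \<Rightarrow> 'v)
     \<Rightarrow> nat \<Rightarrow> (nat \<Rightarrow> 'v) \<Rightarrow> bool"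
  where "weyl_generates scale n X D m f \<longleftrightarrow>
    (\<forall>U. module.subspace scale U \<and> (\<forall>i<m. f i \<in> U) \<and>
         (\<forall>i<n. \<forall>u\<in>U. X i u \<in> U \<and> D i u \<in> U) \<longrightarrow> U = UNIV)"

text \<open>M_rs = sum_i W_rs f_i = span of x^alpha partial^beta f_i with |alpha| \<le> r, |beta| \<le> s.\<close>
definition bifilt ::
  "('k::field \<Rightarrow> 'v::ab_group_add \<Rightarrow> 'v) \<Rightarrow> nat \<Rightarrow> (nat \<Rightarrow> 'v \<Rightarrow> 'v) \<Rightarrow> (nat \<Rightarrow> 'v \<Rightarrow> 'v)
     \<Rightarrow> nat \<Rightarrow> (nat \<Rightarrow> 'v) \<Rightarrow> nat \<Rightarrow> nat \<Rightarrow> 'v set"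
  where "bifilt scale n X D m f r s = module.span scale
    {mon_act n X \<alpha> (mon_act n D \<beta> (f i)) | \<alpha> \<beta> i.
       i < m \<and> (\<Sum>k<n. \<alpha> k) \<le> r \<and> (\<Sum>k<n. \<beta> k) \<le> s}"

end

theory Submission
  imports Defs "HOL-Library.Product_Order"
begin

text \<open>
  Homogenise: a monomial of bidegree at most (r, s) becomes a pair of exponent vectors with one
  additional coordinate each and with coordinate sums exactly r and s, as in the Rees algebra of the
  bifiltration. Order the monomials (together with the generator index) by the total degree in
  x and partial, then lexicographically. The dimension of M_rs is the number of those
  index triples whose vector is not in the span of the smaller ones. Since
  partial_i x_i - x_i partial_i = 1 has lower order, the remaining triples are stable under
  incrementing any coordinate. By Dickson's lemma they form a finite union of orthants, and
  inclusion-exclusion expresses the count by the functions C(r-p+n, n) C(s-q+n, n), which are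
  integral combinations of the C(r+i, i) C(s+j, j) with i, j at most n.
\<close>

subsection \<open>Counting exponent vectors outside an up-closed set\<close>

lemma nat_seq_mono_subseq:
  fixes s :: "nat \<Rightarrow> nat"
  shows "\<exists>g::nat \<Rightarrow> nat. strict_mono g \<and> mono (\<lambda>j. s (g j))"
proof -
  obtain h :: "nat \<Rightarrow> nat" where h: "strict_mono h" "monoseq (\<lambda>j. s (h j))"
    using seq_monosub[of s] by blast
  show ?thesis
  proof (cases "mono (\<lambda>j. s (h j))")
    case True
    then show ?thesis using h by blast
  next
    case False
    then have dec: "s (h j) \<le> s (h i)" if "i \<le> j" for i j
      using h(2) that by (auto simp: monoseq_iff incseq_def decseq_def)
    \<comment> \<open>A decreasing sequence of naturals is constant from the point where it attains
      its minimum, and a constant tail is monotone.\<close>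
    obtain N where N: "\<And>j. s (h N) \<le> s (h j)"
      using ex_has_least_nat[of "\<lambda>_. True" 0 "\<lambda>j. s (h j)"] by auto
    have "s (h (N + j)) = s (h N)" for j
      using N[of "N + j"] dec[of N "N + j"] by simp
    moreover have "strict_mono (\<lambda>j. h (N + j))"
      using h(1) by (simp add: strict_mono_def)
    ultimately show ?thesis
      by (intro exI[of _ "\<lambda>j. h (N + j)"]) (simp add: mono_def)
  qed
qed

text \<open>The subsequence is refined once for each index; the indices treated earlier stay
  monotone under each refinement.\<close>

lemma nat_seqs_mono_subseq:
  fixes s :: "'i \<Rightarrow> nat \<Rightarrow> nat"
  assumes "finite I"
  shows "\<exists>g::nat \<Rightarrow> nat. strict_mono g \<and> (\<forall>i\<in>I. mono (\<lambda>j. s i (g j)))"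
  using assms
proof (induction I)
  case empty
  show ?case by (auto intro: exI[of _ id] strict_mono_id)
next
  case (insert i I)
  then obtain g :: "nat \<Rightarrow> nat" where g: "strict_mono g" "\<forall>i\<in>I. mono (\<lambda>j. s i (g j))" by blast
  obtain h :: "nat \<Rightarrow> nat" where h: "strict_mono h" "mono (\<lambda>j. s i (g (h j)))"
    using nat_seq_mono_subseq[of "\<lambda>j. s i (g j)"] by blast
  have "mono (\<lambda>j. s k (g (h j)))" if "k \<in> I" for k
    using g(2) that h(1) by (simp add: mono_def strict_mono_less_eq)
  then show ?case
    using g(1) h by (intro exI[of _ "\<lambda>j. g (h j)"]) (auto simp: strict_mono_def)
qed

text \<open>If no finite \<open>G\<close> worked, one could keep choosing elements of
  \<open>U\<close> that dominate none of their predecessors. A subsequence along which all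
  coordinates are monotone contradicts this. The coordinates are abstract functions
  \<open>c i\<close>, so that pairs of exponent vectors can be treated directly.\<close>

lemma dickson:
  fixes c :: "'i \<Rightarrow> 'a \<Rightarrow> nat"
  assumes "finite I"
  shows "\<exists>G\<subseteq>U. finite G \<and> (\<forall>u\<in>U. \<exists>g\<in>G. \<forall>i\<in>I. c i g \<le> c i u)"
proof (rule ccontr)
  assume neg: "\<not> ?thesis"
  have "\<exists>x::nat \<Rightarrow> 'a. \<forall>j. x j \<in> U \<and> (\<forall>k<j. \<not> (\<forall>i\<in>I. c i (x k) \<le> c i (x j)))"
  proof (rule dependent_wellorder_choice)
    fix j and x :: "nat \<Rightarrow> 'a"
    assume "\<And>k. k < j \<Longrightarrow> x k \<in> U \<and> (\<forall>l<k. \<not> (\<forall>i\<in>I. c i (x l) \<le> c i (x k)))"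
    then have "x ` {..<j} \<subseteq> U" "finite (x ` {..<j})" by auto
    then show "\<exists>u. u \<in> U \<and> (\<forall>k<j. \<not> (\<forall>i\<in>I. c i (x k) \<le> c i u))"
      using neg by (metis image_eqI lessThan_iff)
  qed auto
  then obtain x :: "nat \<Rightarrow> 'a"
    where x: "\<And>j k. k < j \<Longrightarrow> \<not> (\<forall>i\<in>I. c i (x k) \<le> c i (x j))" by blast
  obtain g :: "nat \<Rightarrow> nat" where g: "strict_mono g" "\<And>i. i \<in> I \<Longrightarrow> mono (\<lambda>j. c i (x (g j)))"
    using nat_seqs_mono_subseq[OF assms, of "\<lambda>i j. c i (x j)"] by blast
  have "g 0 < g 1" using g(1) by (simp add: strict_mono_def)
  moreover have "\<forall>i\<in>I. c i (x (g 0)) \<le> c i (x (g 1))"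
    using g(2) by (auto simp: mono_def)
  ultimately show False using x by blast
qed

section \<open>Exponent vectors with n + 1 coordinates and fixed sum, and their number\<close>

definition comps :: "nat \<Rightarrow> nat \<Rightarrow> (nat \<Rightarrow> nat) set"
  where "comps n r = {\<alpha>. (\<forall>k>n. \<alpha> k = 0) \<and> (\<Sum>k\<le>n. \<alpha> k) = r}"

text \<open>Transports the count to lists, where the stars-and-bars formula
  \<open>card_length_sum_list\<close> applies.\<close>

lemma bij_betw_comps_lists:
  "bij_betw (\<lambda>\<alpha>. map \<alpha> [0..<Suc n]) (comps n r) {l. length l = Suc n \<and> sum_list l = r}"
proof (rule bij_betw_byWitness[where f' = "\<lambda>l k. if k \<le> n then l ! k else 0"])
  show "\<forall>\<alpha>\<in>comps n r. (\<lambda>k. if k \<le> n then map \<alpha> [0..<Suc n] ! k else 0) = \<alpha>"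
    by (auto simp: comps_def fun_eq_iff simp del: upt_Suc)
  show "\<forall>l\<in>{l. length l = Suc n \<and> sum_list l = r}.
      map (\<lambda>k. if k \<le> n then l ! k else 0) [0..<Suc n] = l"
    by (auto intro!: nth_equalityI simp del: upt_Suc)
  show "(\<lambda>\<alpha>. map \<alpha> [0..<Suc n]) ` comps n r \<subseteq> {l. length l = Suc n \<and> sum_list l = r}"
    by (auto simp: comps_def interv_sum_list_conv_sum_set_nat atLeast0LessThan lessThan_Suc_atMost
        simp del: upt_Suc)
  show "(\<lambda>l k. if k \<le> n then l ! k else 0) ` {l. length l = Suc n \<and> sum_list l = r} \<subseteq> comps n r"
    by (auto simp: comps_def sum_list_sum_nth atLeast0LessThan lessThan_Suc_atMost
        intro!: sum.cong)
qed

lemma card_comps: "card (comps n r) = (r + n) choose n"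
  using bij_betw_same_card[OF bij_betw_comps_lists, of n r]
    binomial_symmetric[of n "r + n"]
  by (simp add: card_length_sum_list)

lemma finite_comps: "finite (comps n r)"
  using card_comps[of n r] by (intro card_ge_0_finite) simp

text \<open>Translation by \<open>\<gamma>\<close> identifies this section of an orthant with
  \<open>comps n (r - p)\<close>; truncated subtraction is exact above
  \<open>\<gamma>\<close>.\<close>

lemma card_comps_above:
  assumes "\<gamma> \<in> comps n p" "p \<le> r"
  shows "card {\<alpha> \<in> comps n r. \<gamma> \<le> \<alpha>} = (r - p + n) choose n"
proof -
  have "bij_betw (\<lambda>\<alpha> k. \<alpha> k + \<gamma> k) (comps n (r - p)) {\<alpha> \<in> comps n r. \<gamma> \<le> \<alpha>}"
  proof (rule bij_betw_byWitness[where f' = "\<lambda>\<alpha> k. \<alpha> k - \<gamma> k"])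
    show "(\<lambda>\<alpha> k. \<alpha> k + \<gamma> k) ` comps n (r - p) \<subseteq> {\<alpha> \<in> comps n r. \<gamma> \<le> \<alpha>}"
      using assms by (auto simp: comps_def le_fun_def sum.distrib)
    show "(\<lambda>\<alpha> k. \<alpha> k - \<gamma> k) ` {\<alpha> \<in> comps n r. \<gamma> \<le> \<alpha>} \<subseteq> comps n (r - p)"
      using assms(1) by (auto simp: comps_def le_fun_def sum_subtractf_nat)
  qed (auto simp: le_fun_def fun_eq_iff)
  then show ?thesis
    using bij_betw_same_card card_comps[of n "r - p"] by fastforce
qed

text \<open>Induction on the shift with Pascal's rule C(x+n, n) = C(x+n+1, n) - C(x+n, n-1). The
  last term lowers n, hence n is arbitrary in the induction; only differences are formed, so the
  coefficients stay integral.\<close>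

lemma choose_shift:
  "\<exists>c::nat \<Rightarrow> int. \<forall>r\<ge>p. int ((r - p + n) choose n) = (\<Sum>i\<le>n. c i * int ((r + i) choose i))"
proof (induction p arbitrary: n)
  case 0
  show ?case
  proof (intro exI allI impI)
    fix r :: nat
    show "int ((r - 0 + n) choose n) = (\<Sum>i\<le>n. of_bool (i = n) * int ((r + i) choose i))"
      by (subst sum.remove[of _ n]) (auto intro!: sum.neutral)
  qed
next
  case (Suc p)
  show ?case
  proof (cases n)
    case 0
    show ?thesis by (rule exI[of _ "\<lambda>_. 1"]) (simp add: \<open>n = 0\<close>)
  next
    case (Suc k)
    obtain c where c: "\<forall>r\<ge>p.
        int ((r - p + n) choose n) = (\<Sum>i\<le>n. c i * int ((r + i) choose i))"
      using Suc.IH[of n] ..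
    obtain d where d: "\<forall>r\<ge>p.
        int ((r - p + k) choose k) = (\<Sum>i\<le>k. d i * int ((r + i) choose i))"
      using Suc.IH[of k] ..
    have "int ((r - Suc p + n) choose n)
        = (\<Sum>i\<le>n. (c i - (if i \<le> k then d i else 0)) * int ((r + i) choose i))"
      if "r \<ge> Suc p" for r
    proof -
      define x where "x = r - Suc p"
      have x: "r = Suc (p + x)" using that by (simp add: x_def)
      have "int ((r - Suc p + n) choose n)
          = int ((r - p + n) choose n) - int ((r - p + k) choose k)"
        unfolding x Suc by simp
      also have "\<dots> = (\<Sum>i\<le>n. c i * int ((r + i) choose i)) - (\<Sum>i\<le>k. d i * int ((r + i) choose i))"
        using that by (simp only: c[rule_format] d[rule_format] Suc_leD)
      also have "(\<Sum>i\<le>k. d i * int ((r + i) choose i))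
          = (\<Sum>i\<le>n. (if i \<le> k then d i else 0) * int ((r + i) choose i))"
        using Suc by (intro sum.mono_neutral_cong_left) auto
      finally show ?thesis by (simp only: sum_subtractf left_diff_distrib)
    qed
    then show ?thesis by (intro exI allI impI)
  qed
qed

section \<open>The conclusion of the theorem as a property of functions, with its closure
  rules\<close>

definition eventually_numeric :: "nat \<Rightarrow> (nat \<Rightarrow> nat \<Rightarrow> int) \<Rightarrow> bool"
  where "eventually_numeric n F \<longleftrightarrow>
    (\<exists>a :: nat \<Rightarrow> nat \<Rightarrow> int. \<exists>r0 s0. \<forall>r\<ge>r0. \<forall>s\<ge>s0.
       F r s = (\<Sum>i\<le>n. \<Sum>j\<le>n. a i j * int ((r + i) choose i) * int ((s + j) choose j)))"

lemma eventually_numericI: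
  assumes "\<And>r s. r \<ge> r0 \<Longrightarrow> s \<ge> s0 \<Longrightarrow>
      F r s = (\<Sum>i\<le>n. \<Sum>j\<le>n. a i j * int ((r + i) choose i) * int ((s + j) choose j))"
  shows "eventually_numeric n F"
  using assms unfolding eventually_numeric_def by blast

lemma eventually_numericE:
  assumes "eventually_numeric n F"
  obtains a r0 s0 where "\<And>r s. r \<ge> r0 \<Longrightarrow> s \<ge> s0 \<Longrightarrow>
      F r s = (\<Sum>i\<le>n. \<Sum>j\<le>n. a i j * int ((r + i) choose i) * int ((s + j) choose j))"
  using assms unfolding eventually_numeric_def by blast

lemma eventually_numeric_0: "eventually_numeric n (\<lambda>r s. 0)"
  by (rule eventually_numericI[where a = "\<lambda>_ _. 0"]) simp

lemma eventually_numeric_add: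
  assumes "eventually_numeric n F" "eventually_numeric n G"
  shows "eventually_numeric n (\<lambda>r s. F r s + G r s)"
proof -
  obtain a r0 s0 where F: "\<And>r s. r \<ge> r0 \<Longrightarrow> s \<ge> s0 \<Longrightarrow>
      F r s = (\<Sum>i\<le>n. \<Sum>j\<le>n. a i j * int ((r + i) choose i) * int ((s + j) choose j))"
    using assms(1) by (rule eventually_numericE) (rule that)
  obtain b r1 s1 where G: "\<And>r s. r \<ge> r1 \<Longrightarrow> s \<ge> s1 \<Longrightarrow>
      G r s = (\<Sum>i\<le>n. \<Sum>j\<le>n. b i j * int ((r + i) choose i) * int ((s + j) choose j))"
    using assms(2) by (rule eventually_numericE) (rule that)
  show ?thesis
    by (rule eventually_numericI[where a = "\<lambda>i j. a i j + b i j"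
          and ?r0.0 = "max r0 r1" and ?s0.0 = "max s0 s1"])
       (simp add: F G distrib_right sum.distrib)
qed

lemma eventually_numeric_uminus:
  assumes "eventually_numeric n F"
  shows "eventually_numeric n (\<lambda>r s. - F r s)"
proof -
  obtain a r0 s0 where F: "\<And>r s. r \<ge> r0 \<Longrightarrow> s \<ge> s0 \<Longrightarrow>
      F r s = (\<Sum>i\<le>n. \<Sum>j\<le>n. a i j * int ((r + i) choose i) * int ((s + j) choose j))"
    using assms by (rule eventually_numericE) (rule that)
  show ?thesis
    by (rule eventually_numericI[where a = "\<lambda>i j. - a i j" and ?r0.0 = r0 and ?s0.0 = s0])
       (simp add: F sum_negf)
qed

lemma eventually_numeric_diff:
  "eventually_numeric n F \<Longrightarrow> eventually_numeric n G \<Longrightarrow> eventually_numeric n (\<lambda>r s. F r s - G r s)"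
  using eventually_numeric_add[of n F "\<lambda>r s. - G r s"] eventually_numeric_uminus[of n G] by simp

lemma eventually_numeric_sum:
  "(\<And>i. i \<in> I \<Longrightarrow> eventually_numeric n (F i)) \<Longrightarrow> eventually_numeric n (\<lambda>r s. \<Sum>i\<in>I. F i r s)"
  by (induction I rule: infinite_finite_induct)
     (auto intro: eventually_numeric_0 eventually_numeric_add)

lemma eventually_numeric_cong:
  assumes "eventually_numeric n F"
    and "\<And>r s. r \<ge> p \<Longrightarrow> s \<ge> q \<Longrightarrow> F r s = G r s"
  shows "eventually_numeric n G"
proof -
  obtain a r0 s0 where F: "\<And>r s. r \<ge> r0 \<Longrightarrow> s \<ge> s0 \<Longrightarrow>
      F r s = (\<Sum>i\<le>n. \<Sum>j\<le>n. a i j * int ((r + i) choose i) * int ((s + j) choose j))"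
    using assms(1) by (rule eventually_numericE) (rule that)
  show ?thesis
    by (rule eventually_numericI[where a = a and ?r0.0 = "max r0 p" and ?s0.0 = "max s0 q"])
       (simp flip: assms(2) F)
qed

lemma eventually_numeric_choose:
  "eventually_numeric n (\<lambda>r s. int ((r - p + n) choose n) * int ((s - q + n) choose n))"
proof -
  obtain c where c: "\<forall>r\<ge>p.
      int ((r - p + n) choose n) = (\<Sum>i\<le>n. c i * int ((r + i) choose i))"
    using choose_shift[of p n] ..
  obtain d where d: "\<forall>s\<ge>q.
      int ((s - q + n) choose n) = (\<Sum>i\<le>n. d i * int ((s + i) choose i))"
    using choose_shift[of q n] ..
  show ?thesis
  \<comment> \<open>Below the thresholds p and q the truncated differences are 0, and the expansions
    are asserted only from there on.\<close>
  proof (rule eventually_numericI[where a = "\<lambda>i j. c i * d j" and ?r0.0 = p and ?s0.0 = q])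
    fix r s assume "r \<ge> p" "s \<ge> q"
    then show "int ((r - p + n) choose n) * int ((s - q + n) choose n) =
        (\<Sum>i\<le>n. \<Sum>j\<le>n. c i * d j * int ((r + i) choose i) * int ((s + j) choose j))"
      by (simp only: c[rule_format] d[rule_format] sum_product) (simp only: mult_ac)
  qed
qed

section \<open>Counting in unions of orthants and in up-closed sets\<close>

abbreviation exponents :: "nat \<Rightarrow> (nat \<Rightarrow> nat) set"
  where "exponents n \<equiv> {\<alpha>. \<forall>k>n. \<alpha> k = 0}"

lemma eventually_numeric_card_above:
  assumes "g \<in> exponents n \<times> exponents n"
  shows "eventually_numeric n (\<lambda>r s. int (card {x \<in> comps n r \<times> comps n s. g \<le> x}))"
proof -
  obtain \<gamma> \<delta> where g: "g = (\<gamma>, \<delta>)" by fastforce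
  define p q where "p = (\<Sum>k\<le>n. \<gamma> k)" and "q = (\<Sum>k\<le>n. \<delta> k)"
  have mem: "\<gamma> \<in> comps n p" "\<delta> \<in> comps n q"
    using assms by (auto simp: g comps_def p_def q_def)
  have eq: "{x \<in> comps n r \<times> comps n s. g \<le> x} =
      {\<alpha> \<in> comps n r. \<gamma> \<le> \<alpha>} \<times> {\<beta> \<in> comps n s. \<delta> \<le> \<beta>}" for r s
    by (auto simp: g)
  show ?thesis
    by (rule eventually_numeric_cong[OF eventually_numeric_choose[of n p q], of p q])
       (simp only: eq card_cartesian_product card_comps_above[OF mem(1)]
         card_comps_above[OF mem(2)] of_nat_mult)
qed

text \<open>Inclusion-exclusion, one orthant at a time. The orthant of \<open>g\<close> meets the
  union of the orthants of \<open>G'\<close> in the union of the orthants of \<open>sup g h\<close>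
  for \<open>h\<close> in \<open>G'\<close>. These suprema form a different set, but one with at
  most \<open>card G'\<close> elements, so the induction runs on the cardinality.\<close>

lemma eventually_numeric_card_above_finite:
  assumes "finite G" "G \<subseteq> exponents n \<times> exponents n"
  shows "eventually_numeric n (\<lambda>r s. int (card {x \<in> comps n r \<times> comps n s. \<exists>g\<in>G. g \<le> x}))"
  using assms
proof (induction "card G" arbitrary: G rule: less_induct)
  case less
  show ?case
  proof (cases "G = {}")
    case True
    then show ?thesis by (simp add: eventually_numeric_0)
  next
    case False
    then obtain g G' where G: "G = insert g G'" "g \<notin> G'" by (meson mk_disjoint_insert ex_in_conv)
    let ?A = "\<lambda>(H :: ((nat \<Rightarrow> nat) \<times> (nat \<Rightarrow> nat)) set) r s. {x \<in> comps n r \<times> comps n s. \<exists>h\<in>H. h \<le> x}"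
    let ?L = "sup g ` G'"
    have fin: "finite (?A H r s)" for H r s
      by (rule finite_subset[OF _ finite_cartesian_product[OF finite_comps finite_comps]]) auto
    have "?A G r s = ?A G' r s \<union> ?A {g} r s" "?A ?L r s = ?A G' r s \<inter> ?A {g} r s" for r s
      by (auto simp: G)
    then have card: "int (card (?A G' r s)) + int (card (?A {g} r s)) - int (card (?A ?L r s))
        = int (card (?A G r s))" for r s
      using card_Un_Int[of "?A G' r s" "?A {g} r s"] fin by (simp only:) simp
    have fG: "finite G'" and cG: "card G' < card G" using less.prems G by auto
    have sub: "G' \<subseteq> exponents n \<times> exponents n" "g \<in> exponents n \<times> exponents n"
      using less.prems G by auto
    have cL: "card ?L < card G" using card_image_le[OF fG, of "sup g"] cG by simp
    have subL: "?L \<subseteq> exponents n \<times> exponents n"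
      using sub by (auto simp: sup_prod_def subset_iff sup_nat_def)
    have "eventually_numeric n (\<lambda>r s. int (card (?A G' r s)))"
      using less.hyps[OF cG fG sub(1)] .
    moreover have "eventually_numeric n (\<lambda>r s. int (card (?A ?L r s)))"
      using less.hyps[OF cL _ subL] fG by simp
    moreover have "eventually_numeric n (\<lambda>r s. int (card (?A {g} r s)))"
      using eventually_numeric_card_above[OF sub(2)] by simp
    ultimately have "eventually_numeric n (\<lambda>r s. int (card (?A G' r s)) + int (card (?A {g} r s))
        - int (card (?A ?L r s)))"
      by (intro eventually_numeric_diff eventually_numeric_add)
    then show ?thesis by (simp only: card)
  qed
qed

text \<open>Climbs to \<open>\<alpha>'\<close> by unit steps at a coordinate that is still too
  small. Such a coordinate is at most n because \<open>\<alpha>'\<close> vanishes above n, and the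
  total deficit drops at each step.\<close>

lemma exponents_step_induct:
  assumes "\<alpha> \<le> \<alpha>'" "\<alpha>' \<in> exponents n" "Q \<alpha>"
    and step: "\<And>\<alpha> k. \<alpha> \<in> exponents n \<Longrightarrow> k \<le> n \<Longrightarrow> Q \<alpha> \<Longrightarrow> Q (\<alpha>(k := Suc (\<alpha> k)))"
  shows "Q \<alpha>'"
  using assms(1,3)
proof (induction "\<Sum>k\<le>n. \<alpha>' k - \<alpha> k" arbitrary: \<alpha> rule: less_induct)
  case less
  show ?case
  proof (cases "\<alpha> = \<alpha>'")
    case True
    then show ?thesis using less by simp
  next
    case False
    then obtain k where k: "\<alpha> k < \<alpha>' k"
      using less.prems(1) by (metis le_funD nless_le ext)
    then have kn: "k \<le> n" using assms(2) by (metis (mono_tags) mem_Collect_eq not_less_zero not_le)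
    let ?b = "\<alpha>(k := Suc (\<alpha> k))"
    have "\<alpha> \<in> exponents n" using less.prems(1) assms(2) by (auto simp: le_fun_def) (metis le_0_eq)
    then have "Q ?b" using step kn less.prems by blast
    moreover have "?b \<le> \<alpha>'" using k less.prems(1) by (auto simp: le_fun_def)
    moreover have "(\<Sum>k\<le>n. \<alpha>' k - ?b k) < (\<Sum>k\<le>n. \<alpha>' k - \<alpha> k)"
      by (rule sum_strict_mono_ex1) (use k kn in \<open>auto intro!: bexI[of _ k]\<close>)
    ultimately show ?thesis using less.hyps by blast
  qed
qed

text \<open>Dickson's lemma gives finitely many solutions of \<open>P\<close> such that every
  solution lies above one of them; the step hypotheses make everything above them a solution. So for
  all r and s at once the solutions are the points of one finite union of orthants.\<close>

lemma eventually_numeric_card_upset: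
  assumes step1: "\<And>\<alpha> \<beta> k. \<alpha> \<in> exponents n \<Longrightarrow> \<beta> \<in> exponents n \<Longrightarrow> k \<le> n \<Longrightarrow> P (\<alpha>, \<beta>) \<Longrightarrow>
      P (\<alpha>(k := Suc (\<alpha> k)), \<beta>)"
    and step2: "\<And>\<alpha> \<beta> k. \<alpha> \<in> exponents n \<Longrightarrow> \<beta> \<in> exponents n \<Longrightarrow> k \<le> n \<Longrightarrow> P (\<alpha>, \<beta>) \<Longrightarrow>
      P (\<alpha>, \<beta>(k := Suc (\<beta> k)))"
  shows "eventually_numeric n (\<lambda>r s. int (card {x \<in> comps n r \<times> comps n s. P x}))"
proof -
  define U where "U = {x \<in> exponents n \<times> exponents n. P x}"
  \<comment> \<open>The pair is read as one family of 2(n + 1) coordinates, the Boolean selecting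
    the vector. Coordinates above n vanish on \<open>U\<close>, so this finite family decides the
    order.\<close>
  define c :: "bool \<times> nat \<Rightarrow> (nat \<Rightarrow> nat) \<times> (nat \<Rightarrow> nat) \<Rightarrow> nat"
    where "c = (\<lambda>(b, k) (\<alpha>, \<beta>). if b then \<alpha> k else \<beta> k)"
  have "\<exists>G\<subseteq>U. finite G \<and> (\<forall>u\<in>U. \<exists>g\<in>G. \<forall>i\<in>UNIV \<times> {..n}. c i g \<le> c i u)"
    by (rule dickson) simp
  then obtain G where G: "G \<subseteq> U" "finite G"
    and dom: "\<And>u. u \<in> U \<Longrightarrow> \<exists>g\<in>G. \<forall>i\<in>UNIV \<times> {..n}. c i g \<le> c i u"
    by blast
  have le: "g \<le> u" if g: "g \<in> G" "u \<in> U" "\<forall>i\<in>UNIV \<times> {..n}. c i g \<le> c i u" for g u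
  proof -
    obtain \<gamma> \<delta> where [simp]: "g = (\<gamma>, \<delta>)" by (cases g)
    obtain \<alpha> \<beta> where [simp]: "u = (\<alpha>, \<beta>)" by (cases u)
    have "\<gamma> k \<le> \<alpha> k \<and> \<delta> k \<le> \<beta> k" for k
    proof (cases "k \<le> n")
      case True
      then show ?thesis using g(3)[rule_format, of "(True, k)"] g(3)[rule_format, of "(False, k)"]
        by (simp add: c_def)
    next
      case False
      then show ?thesis using g(1) G(1) by (auto simp: U_def)
    qed
    then show ?thesis by (simp add: le_fun_def)
  qed
  have up: "P u" if "g \<in> G" "g \<le> u" "u \<in> exponents n \<times> exponents n" for g u
  proof -
    obtain \<gamma> \<delta> where [simp]: "g = (\<gamma>, \<delta>)" by (cases g)
    obtain \<alpha> \<beta> where [simp]: "u = (\<alpha>, \<beta>)" by (cases u)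
    have *: "P (\<gamma>, \<delta>)" "\<gamma> \<in> exponents n" "\<delta> \<in> exponents n" "\<gamma> \<le> \<alpha>" "\<delta> \<le> \<beta>"
        "\<alpha> \<in> exponents n" "\<beta> \<in> exponents n"
      using that G(1) by (auto simp: U_def)
    \<comment> \<open>The first vector is raised while the second stays fixed, then the
      second.\<close>
    have "P (\<alpha>, \<delta>)"
      by (rule exponents_step_induct[where Q = "\<lambda>x. P (x, \<delta>)" and n = n and \<alpha> = \<gamma>])
         (use * step1 in auto)
    then have "P (\<alpha>, \<beta>)"
      by (rule exponents_step_induct[where Q = "\<lambda>x. P (\<alpha>, x)" and n = n and \<alpha> = \<delta>, rotated 2])
         (use * step2 in auto)
    then show ?thesis by simp
  qed
  have "P x \<longleftrightarrow> (\<exists>g\<in>G. g \<le> x)" if "x \<in> comps n r \<times> comps n s" for x r s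
  proof -
    have x: "x \<in> exponents n \<times> exponents n" using that by (auto simp: comps_def)
    show ?thesis
    proof
      assume "P x"
      then have "x \<in> U" using x by (simp add: U_def)
      then show "\<exists>g\<in>G. g \<le> x" using dom le by blast
    next
      assume "\<exists>g\<in>G. g \<le> x"
      then show "P x" using up x by blast
    qed
  qed
  then have "{x \<in> comps n r \<times> comps n s. P x} = {x \<in> comps n r \<times> comps n s. \<exists>g\<in>G. g \<le> x}" for r s
    by blast
  moreover have "eventually_numeric n
      (\<lambda>r s. int (card {x \<in> comps n r \<times> comps n s. \<exists>g\<in>G. g \<le> x}))"
    using G by (intro eventually_numeric_card_above_finite) (auto simp: U_def)
  ultimately show ?thesis by simp
qed

subsection \<open>Weyl algebra actions on monomials\<close>

text \<open>Greedy choice of a basis. Removing a maximal \<open>z\<close> leaves the lower sets of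
  the other indices unchanged, and by totality all of them lie below \<open>z\<close>. Thus
  \<open>w z\<close> is either redundant or enlarges the basis by one vector. \<open>w\<close> may
  repeat values: among indices with equal vectors at most the smallest is counted.\<close>

lemma (in vector_space) dim_eq_card_not_in_span_smaller:
  assumes "finite T" "trans R" "irrefl R" "total R"
  shows "dim (span (w ` T)) = card {x \<in> T. w x \<notin> span (w ` {y \<in> T. (y, x) \<in> R})}"
proof -
  have "\<exists>B. finite B \<and> independent B \<and> span B = span (w ` T) \<and>
      card B = card {x \<in> T. w x \<notin> span (w ` {y \<in> T. (y, x) \<in> R})}"
    using assms(1)
  proof (induction "card T" arbitrary: T rule: less_induct)
    case less
    show ?case
    proof (cases "T = {}")
      case True
      then show ?thesis by (auto intro!: exI[of _ "{}"] simp: independent_empty)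
    next
      case False
      have "\<exists>z\<in>T. \<forall>y\<in>T. (z, y) \<notin> R"
        using less.prems False
      proof (induction T rule: finite_ne_induct)
        case (singleton x)
        then show ?case using \<open>irrefl R\<close> by (simp add: irrefl_def)
      next
        case (insert x F)
        then obtain z where z: "z \<in> F" "\<forall>y\<in>F. (z, y) \<notin> R" by blast
        show ?case
        proof (cases "(z, x) \<in> R")
          case True
          then have "\<forall>y\<in>insert x F. (x, y) \<notin> R"
            using z \<open>trans R\<close> \<open>irrefl R\<close> by (metis insert_iff irrefl_def transD)
          then show ?thesis by blast
        next
          case False
          then show ?thesis using z by blast
        qed
      qed
      then obtain z where z: "z \<in> T" "\<forall>y\<in>T. (z, y) \<notin> R" by blast
      define T' where "T' = T - {z}"
      have T: "T = insert z T'" "z \<notin> T'" "finite T'" using z less.prems by (auto simp: T'_def)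
      have zT: "{y \<in> T. (y, z) \<in> R} = T'"
        using z \<open>total R\<close> \<open>irrefl R\<close> by (auto simp: T'_def total_on_def irrefl_def)
      have below: "{y \<in> T. (y, x) \<in> R} = {y \<in> T'. (y, x) \<in> R}" if "x \<in> T'" for x
        using z that by (auto simp: T'_def)
      let ?S = "{x \<in> T'. w x \<notin> span (w ` {y \<in> T'. (y, x) \<in> R})}"
      have "card T' < card T" using T less.prems by simp
      then obtain B where B: "finite B" "independent B" "span B = span (w ` T')" "card B = card ?S"
        using less.hyps T(3) by blast
      have eq: "{x \<in> T. w x \<notin> span (w ` {y \<in> T. (y, x) \<in> R})}
          = (if w z \<in> span B then ?S else insert z ?S)"
        using z(1) zT below B(3) by (auto simp: T)
      show ?thesis
      proof (cases "w z \<in> span B")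
        case True
        then have "span (w ` T) = span (w ` T')"
          using B(3) by (simp add: T span_redundant)
        then show ?thesis using B True eq by auto
      next
        case False
        then have "w z \<notin> B" using span_base by blast
        moreover have "span (insert (w z) B) = span (w ` T)"
          by (simp add: T(1) span_insert B(3))
        moreover have "independent (insert (w z) B)"
          using False B by (simp add: independent_insertI)
        ultimately show ?thesis
          using B T(2,3) False eq by (intro exI[of _ "insert (w z) B"]) simp
      qed
    qed
  qed
  then show ?thesis by (metis dim_eq_card span_span)
qed

text \<open>Only coordinates below n act, which leaves coordinate n free to store slack.\<close>

lemma mon_act_cong:
  assumes "\<And>k. k < n \<Longrightarrow> \<alpha> k = \<beta> k"
  shows "mon_act n Y \<alpha> = mon_act n Y \<beta>"
  unfolding mon_act_def by (rule foldr_cong) (auto simp: assms)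

text \<open>Replaces \<open>[0..<n]\<close> in \<open>mon_act\<close> by an arbitrary list, so that
  facts about moving a generator past the factors can be proved by induction on the list.\<close>

definition list_act :: "(nat \<Rightarrow> 'v \<Rightarrow> 'v) \<Rightarrow> (nat \<Rightarrow> nat) \<Rightarrow> nat list \<Rightarrow> 'v \<Rightarrow> 'v"
  where "list_act Y \<alpha> ks = foldr (\<lambda>i g. (Y i ^^ \<alpha> i) \<circ> g) ks id"

lemma list_act_simps [simp]:
  "list_act Y \<alpha> [] v = v"
  "list_act Y \<alpha> (i # ks) v = (Y i ^^ \<alpha> i) (list_act Y \<alpha> ks v)"
  by (simp_all add: list_act_def)

lemma mon_act_eq_list_act: "mon_act n Y \<alpha> = list_act Y \<alpha> [0..<n]"
  by (simp add: mon_act_def list_act_def)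

lemma list_act_fun_upd_other: "k \<notin> set ks \<Longrightarrow> list_act Y (\<alpha>(k := a)) ks v = list_act Y \<alpha> ks v"
  by (induction ks) auto

lemma funpow_commute:
  assumes "\<And>v. g (f v) = f (g v)"
  shows "g ((f ^^ a) v) = (f ^^ a) (g v)"
  by (induction a) (simp_all add: assms)

text \<open>\<open>Y k\<close> moves past each factor until it meets the power of \<open>Y k\<close>
  itself and is absorbed there; distinctness keeps the raised exponent out of the remaining
  list.\<close>

lemma list_act_step:
  assumes "\<And>i v. i \<in> set ks \<Longrightarrow> Y k (Y i v) = Y i (Y k v)"
    and "distinct ks" "k \<in> set ks"
  shows "Y k (list_act Y \<alpha> ks v) = list_act Y (\<alpha>(k := Suc (\<alpha> k))) ks v"
  using assms
proof (induction ks)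
  case (Cons i ks)
  show ?case
  proof (cases "i = k")
    case True
    then have "list_act Y (\<alpha>(k := Suc (\<alpha> k))) ks v = list_act Y \<alpha> ks v"
      using Cons.prems by (intro list_act_fun_upd_other) simp
    then show ?thesis using True by (simp del: fun_upd_apply) simp
  next
    case False
    have "Y k (list_act Y \<alpha> (i # ks) v) = (Y i ^^ \<alpha> i) (Y k (list_act Y \<alpha> ks v))"
      using Cons.prems(1)[of i] by (simp add: funpow_commute)
    then show ?thesis using Cons False by simp
  qed
qed simp

lemma mon_act_step:
  assumes "\<And>i v. i < n \<Longrightarrow> Y k (Y i v) = Y i (Y k v)" "k < n"
  shows "Y k (mon_act n Y \<alpha> v) = mon_act n Y (\<alpha>(k := Suc (\<alpha> k))) v"
  unfolding mon_act_eq_list_act by (rule list_act_step) (use assms in auto)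

section \<open>Moving a derivation past a monomial in the variables\<close>

locale weyl_module_family =
  fixes scale :: "'k::field \<Rightarrow> 'v::ab_group_add \<Rightarrow> 'v"
    and n m :: nat and X D :: "nat \<Rightarrow> 'v \<Rightarrow> 'v" and f :: "nat \<Rightarrow> 'v"
  assumes weyl: "weyl_module scale n X D"
begin

sublocale vector_space scale
  using weyl by (simp add: weyl_module_def)

lemma linear_X: "k < n \<Longrightarrow> Vector_Spaces.linear scale scale (X k)"
  and linear_D: "k < n \<Longrightarrow> Vector_Spaces.linear scale scale (D k)"
  and X_X: "i < n \<Longrightarrow> j < n \<Longrightarrow> X i (X j v) = X j (X i v)"
  and D_D: "i < n \<Longrightarrow> j < n \<Longrightarrow> D i (D j v) = D j (D i v)"
  and D_X: "i < n \<Longrightarrow> j < n \<Longrightarrow> i \<noteq> j \<Longrightarrow> D i (X j v) = X j (D i v)"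
  and D_X_same: "i < n \<Longrightarrow> D i (X i v) = X i (D i v) + v"
  using weyl by (simp_all add: weyl_module_def)

lemma X_add: "k < n \<Longrightarrow> X k (u + v) = X k u + X k v"
  and X_scale: "k < n \<Longrightarrow> X k (scale c v) = scale c (X k v)"
  using linear_X by (simp_all add: Vector_Spaces.linear_iff)

lemma X_pow_0: "k < n \<Longrightarrow> (X k ^^ a) 0 = 0"
  using X_scale[of k 0 0] by (induction a) simp_all

lemma X_pow_add: "k < n \<Longrightarrow> (X k ^^ a) (u + v) = (X k ^^ a) u + (X k ^^ a) v"
  by (induction a) (simp_all add: X_add)

lemma X_pow_scale: "k < n \<Longrightarrow> (X k ^^ a) (scale c v) = scale c ((X k ^^ a) v)"
  by (induction a) (simp_all add: X_scale)

text \<open>The commutator of partial with x^a is the derivative a x^(a-1). For \<open>a = 0\<close>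
  the coefficient is zero, so the truncated \<open>a - 1\<close> does no harm.\<close>

lemma D_X_pow: "k < n \<Longrightarrow>
    D k ((X k ^^ a) v) = (X k ^^ a) (D k v) + scale (of_nat a) ((X k ^^ (a - 1)) v)"
proof (induction a)
  case (Suc a)
  have "X k (scale (of_nat a) ((X k ^^ (a - 1)) v)) = scale (of_nat a) ((X k ^^ a) v)"
    using Suc.prems X_pow_0[of k 1] by (cases a) (simp_all add: X_scale)
  then show ?case
    using Suc by (simp add: D_X_same X_add scale_left_distrib add_ac)
qed simp

text \<open>\<open>D k\<close> commutes with every factor except the power of \<open>X k\<close>,
  where \<open>D_X_pow\<close> produces the derivative term. The case distinction covers tails of
  the list that no longer contain \<open>k\<close>.\<close>

lemma D_list_act:
  assumes "k < n" "set ks \<subseteq> {..<n}" "distinct ks"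
  shows "D k (list_act X \<alpha> ks v) = list_act X \<alpha> ks (D k v) +
    (if k \<in> set ks then scale (of_nat (\<alpha> k)) (list_act X (\<alpha>(k := \<alpha> k - 1)) ks v) else 0)"
  using assms(2,3)
proof (induction ks)
  case (Cons i ks)
  show ?case
  proof (cases "i = k")
    case True
    then have "list_act X (\<alpha>(k := \<alpha> k - 1)) ks v = list_act X \<alpha> ks v"
      using Cons.prems by (intro list_act_fun_upd_other) simp
    then show ?thesis
      using Cons True assms(1) by (simp add: D_X_pow)
  next
    case False
    have "D k (list_act X \<alpha> (i # ks) v) = (X i ^^ \<alpha> i) (D k (list_act X \<alpha> ks v))"
      using Cons.prems False assms(1) by (simp add: funpow_commute[of "D k"] D_X)
    then show ?thesis
      using Cons False by (simp add: X_pow_0 X_pow_add X_pow_scale)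
  qed
qed simp

lemma D_mon_act:
  assumes "k < n"
  shows "D k (mon_act n X \<alpha> v) = mon_act n X \<alpha> (D k v) +
    scale (of_nat (\<alpha> k)) (mon_act n X (\<alpha>(k := \<alpha> k - 1)) v)"
  using D_list_act[OF assms, of "[0..<n]"] assms by (simp add: mon_act_eq_list_act atLeast0LessThan)

end

subsection \<open>Reducible monomials\<close>

definition lex_less :: "((nat \<Rightarrow> nat) \<times> (nat \<Rightarrow> nat)) set"
  where "lex_less = {(\<alpha>, \<beta>). \<exists>k. \<alpha> k < \<beta> k \<and> (\<forall>j<k. \<alpha> j = \<beta> j)}"

lemma irrefl_lex_less: "irrefl lex_less"
  by (auto simp: irrefl_def lex_less_def)

lemma trans_lex_less: "trans lex_less"
proof (rule transI)
  fix \<alpha> \<beta> \<gamma> assume "(\<alpha>, \<beta>) \<in> lex_less" "(\<beta>, \<gamma>) \<in> lex_less"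
  then obtain k l where "\<alpha> k < \<beta> k" "\<forall>j<k. \<alpha> j = \<beta> j" "\<beta> l < \<gamma> l" "\<forall>j<l. \<beta> j = \<gamma> j"
    by (auto simp: lex_less_def)
  \<comment> \<open>The earlier of the two deciding positions decides between
    \<open>\<alpha>\<close> and \<open>\<gamma>\<close>.\<close>
  then have "\<alpha> (min k l) < \<gamma> (min k l) \<and> (\<forall>j<min k l. \<alpha> j = \<gamma> j)"
    by (cases k l rule: linorder_cases) (auto simp: min_def)
  then show "(\<alpha>, \<gamma>) \<in> lex_less" by (auto simp: lex_less_def)
qed

lemma total_lex_less: "total lex_less"
proof (rule totalI)
  fix \<alpha> \<beta> :: "nat \<Rightarrow> nat" assume "\<alpha> \<noteq> \<beta>"
  then obtain k where "\<alpha> k \<noteq> \<beta> k" "\<forall>j<k. \<alpha> j = \<beta> j"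
    using exists_least_iff[of "\<lambda>k. \<alpha> k \<noteq> \<beta> k"] by auto
  then have "(\<alpha> k < \<beta> k \<or> \<beta> k < \<alpha> k) \<and> (\<forall>j<k. \<alpha> j = \<beta> j)" by auto
  then show "(\<alpha>, \<beta>) \<in> lex_less \<or> (\<beta>, \<alpha>) \<in> lex_less" by (fastforce simp: lex_less_def)
qed

definition incr :: "nat \<Rightarrow> (nat \<Rightarrow> nat) \<Rightarrow> nat \<Rightarrow> nat"
  where "incr k \<alpha> = \<alpha>(k := Suc (\<alpha> k))"

lemma lex_less_incr_iff: "(incr k \<alpha>, incr k \<beta>) \<in> lex_less \<longleftrightarrow> (\<alpha>, \<beta>) \<in> lex_less"
proof -
  have "incr k \<alpha> j < incr k \<beta> j \<longleftrightarrow> \<alpha> j < \<beta> j" "incr k \<alpha> j = incr k \<beta> j \<longleftrightarrow> \<alpha> j = \<beta> j" for j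
    by (simp_all add: incr_def)
  then show ?thesis by (simp add: lex_less_def)
qed

lemma incr_eq_iff: "incr k \<alpha> = incr k \<beta> \<longleftrightarrow> \<alpha> = \<beta>"
  by (auto simp: incr_def fun_eq_iff split: if_splits)

text \<open>Written with sums on both sides, so that no truncated subtraction arises when an entry
  is lowered.\<close>

lemma sum_fun_upd:
  fixes \<alpha> :: "'a \<Rightarrow> nat"
  assumes "finite A"
  shows "(\<Sum>j\<in>A. (\<alpha>(k := a)) j) + (if k \<in> A then \<alpha> k else 0) = (\<Sum>j\<in>A. \<alpha> j) + (if k \<in> A then a else 0)"
proof (cases "k \<in> A")
  case True
  have "(\<Sum>j\<in>A - {k}. (\<alpha>(k := a)) j) = (\<Sum>j\<in>A - {k}. \<alpha> j)"
    by (rule sum.cong) auto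
  then show ?thesis using True assms by (simp add: sum.remove)
next
  case False
  then show ?thesis by (auto intro!: sum.cong)
qed

lemma sum_incr: "finite A \<Longrightarrow> (\<Sum>j\<in>A. incr k \<alpha> j) = (\<Sum>j\<in>A. \<alpha> j) + (if k \<in> A then 1 else 0)"
  using sum_fun_upd[of A \<alpha> k "Suc (\<alpha> k)"] by (auto simp: incr_def split: if_splits)

lemma incr_in_comps: "\<alpha> \<in> comps n r \<Longrightarrow> k \<le> n \<Longrightarrow> incr k \<alpha> \<in> comps n (Suc r)"
  using sum_incr[of "{..n}" k \<alpha>] by (simp add: comps_def incr_def)

type_synonym index = "((nat \<Rightarrow> nat) \<times> (nat \<Rightarrow> nat)) \<times> nat"

text \<open>The degree omits coordinate n, so a lower-order term padded in that coordinate still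
  counts as strictly smaller. The vectors and the generator index break ties and make the key
  injective.\<close>

fun order_key :: "nat \<Rightarrow> index \<Rightarrow> nat \<times> (nat \<Rightarrow> nat) \<times> (nat \<Rightarrow> nat) \<times> nat"
  where "order_key n ((\<alpha>, \<beta>), i) = ((\<Sum>k<n. \<alpha> k) + (\<Sum>k<n. \<beta> k), \<alpha>, \<beta>, i)"

definition index_less :: "nat \<Rightarrow> (index \<times> index) set"
  where "index_less n =
    inv_image (less_than <*lex*> lex_less <*lex*> lex_less <*lex*> less_than) (order_key n)"

lemma inj_order_key: "inj (order_key n)"
  by (rule injI) auto

lemma irrefl_index_less: "irrefl (index_less n)"
  using irrefl_lex_less by (auto simp: irrefl_def index_less_def)

lemma trans_index_less: "trans (index_less n)"
  unfolding index_less_def by (intro trans_inv_image trans_lex_prod trans_lex_less trans_less_than)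

lemma total_index_less: "total (index_less n)"
  unfolding index_less_def
  by (intro total_inv_image inj_order_key total_lex_prod total_lex_less total_less_than)

fun incr_fst :: "nat \<Rightarrow> index \<Rightarrow> index" where "incr_fst k ((\<alpha>, \<beta>), i) = ((incr k \<alpha>, \<beta>), i)"
fun incr_snd :: "nat \<Rightarrow> index \<Rightarrow> index" where "incr_snd k ((\<alpha>, \<beta>), i) = ((\<alpha>, incr k \<beta>), i)"

text \<open>The increment shifts both degrees by the same amount, 1 or 0 according to whether
  \<open>k < n\<close>, and respects the lexicographic comparison. Hence an increment carries
  indices below \<open>x\<close> to indices below the incremented \<open>x\<close>.\<close>

lemma index_less_incr_fst: "(incr_fst k y, incr_fst k x) \<in> index_less n \<longleftrightarrow> (y, x) \<in> index_less n"
  by (cases x; cases y)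
     (auto simp: index_less_def sum_incr lex_less_incr_iff incr_eq_iff)

lemma index_less_incr_snd: "(incr_snd k y, incr_snd k x) \<in> index_less n \<longleftrightarrow> (y, x) \<in> index_less n"
  by (cases x; cases y)
     (auto simp: index_less_def sum_incr lex_less_incr_iff incr_eq_iff)

abbreviation indices :: "nat \<Rightarrow> nat \<Rightarrow> nat \<Rightarrow> nat \<Rightarrow> index set"
  where "indices n m r s \<equiv> (comps n r \<times> comps n s) \<times> {..<m}"

lemma incr_fst_in_indices: "x \<in> indices n m r s \<Longrightarrow> k \<le> n \<Longrightarrow> incr_fst k x \<in> indices n m (Suc r) s"
  by (cases x) (auto simp: incr_in_comps)

lemma incr_snd_in_indices: "x \<in> indices n m r s \<Longrightarrow> k \<le> n \<Longrightarrow> incr_snd k x \<in> indices n m r (Suc s)"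
  by (cases x) (auto simp: incr_in_comps)

section \<open>Stability of reducible indices and the dimension count\<close>

context weyl_module_family
begin

text \<open>The coordinate n of either exponent vector is the homogenising one: it does not act.\<close>

fun vec :: "index \<Rightarrow> 'v"
  where "vec ((\<alpha>, \<beta>), i) = mon_act n X \<alpha> (mon_act n D \<beta> (f i))"

lemma bifilt_eq_span_vec: "bifilt scale n X D m f r s = span (vec ` indices n m r s)"
proof -
  have homogenise: "\<exists>\<alpha>'\<in>comps n r. \<forall>Y :: nat \<Rightarrow> 'v \<Rightarrow> 'v. mon_act n Y \<alpha>' = mon_act n Y \<alpha>"
    if "(\<Sum>k<n. \<alpha> k) \<le> r" for \<alpha> r
  proof (intro bexI allI)
    let ?a = "\<lambda>k. if k < n then \<alpha> k else if k = n then r - (\<Sum>k<n. \<alpha> k) else 0"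
    show "mon_act n Y ?a = mon_act n Y \<alpha>" for Y :: "nat \<Rightarrow> 'v \<Rightarrow> 'v"
      by (rule mon_act_cong) simp
    show "?a \<in> comps n r"
      using that by (simp add: comps_def flip: lessThan_Suc_atMost)
  qed
  have le: "(\<Sum>k<n. \<alpha> k) \<le> r" if "\<alpha> \<in> comps n r" for \<alpha> r
    using that by (auto simp: comps_def simp flip: lessThan_Suc_atMost)
  have "{mon_act n X \<alpha> (mon_act n D \<beta> (f i)) |\<alpha> \<beta> i.
      i < m \<and> (\<Sum>k<n. \<alpha> k) \<le> r \<and> (\<Sum>k<n. \<beta> k) \<le> s} = vec ` indices n m r s" (is "?L = ?R")
  proof
    show "?R \<subseteq> ?L" using le by fastforce
    show "?L \<subseteq> ?R"
    proof
      fix v assume "v \<in> ?L"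
      then obtain \<alpha> \<beta> i where v: "v = mon_act n X \<alpha> (mon_act n D \<beta> (f i))" "i < m"
          "(\<Sum>k<n. \<alpha> k) \<le> r" "(\<Sum>k<n. \<beta> k) \<le> s" by blast
      obtain \<alpha>' where a: "\<alpha>' \<in> comps n r" "mon_act n X \<alpha>' = mon_act n X \<alpha>"
        using homogenise[OF v(3)] by blast
      obtain \<beta>' where b: "\<beta>' \<in> comps n s" "mon_act n D \<beta>' = mon_act n D \<beta>"
        using homogenise[OF v(4)] by blast
      have "v = vec ((\<alpha>', \<beta>'), i)" using v(1) a(2) b(2) by simp
      then show "v \<in> ?R" using a(1) b(1) v(2) by blast
    qed
  qed
  then show ?thesis by (simp add: bifilt_def)
qed

abbreviation lower :: "nat \<Rightarrow> nat \<Rightarrow> index \<Rightarrow> index set"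
  where "lower r s x \<equiv> {y \<in> indices n m r s. (y, x) \<in> index_less n}"

text \<open>Says that \<open>x\<close> is the leading index of a linear relation in bidegree (r, s),
  much as leading monomials are used for Groebner bases.\<close>

definition reducible :: "nat \<Rightarrow> nat \<Rightarrow> index \<Rightarrow> bool"
  where "reducible r s x \<longleftrightarrow> vec x \<in> span (vec ` lower r s x)"

lemma vec_incr_fst: "vec (incr_fst k x) = (if k < n then X k (vec x) else vec x)"
proof -
  obtain \<alpha> \<beta> i where fields: "x = ((\<alpha>, \<beta>), i)" by (metis prod.exhaust)
  have "mon_act n X (incr k \<alpha>) = mon_act n X \<alpha>" if "\<not> k < n"
    by (rule mon_act_cong) (use that in \<open>auto simp: incr_def\<close>)
  moreover have "X k (mon_act n X \<alpha> v) = mon_act n X (incr k \<alpha>) v" if "k < n" for v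
    unfolding incr_def by (rule mon_act_step) (use that X_X in auto)
  ultimately show ?thesis by (simp add: fields)
qed

lemma vec_incr_snd_last: "vec (incr_snd n x) = vec x"
proof -
  obtain \<alpha> \<beta> i where fields: "x = ((\<alpha>, \<beta>), i)" by (metis prod.exhaust)
  have "mon_act n D (incr n \<beta>) = mon_act n D \<beta>"
    by (rule mon_act_cong) (simp add: incr_def)
  then show ?thesis by (simp add: fields)
qed

text \<open>Moving \<open>D k\<close> past the powers of x raises one exponent of partial and leaves
  one derivative term. That term has total degree two less than the incremented monomial, so it is
  smaller in the order.\<close>

lemma D_vec:
  assumes "x \<in> indices n m r s" "k < n"
  shows "\<exists>u \<in> span (vec ` lower r (Suc s) (incr_snd k x)). D k (vec x) = vec (incr_snd k x) + u"
proof -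
  obtain \<alpha> \<beta> i where x: "x = ((\<alpha>, \<beta>), i)" by (metis prod.exhaust)
  have step: "D k (mon_act n D \<beta> v) = mon_act n D (incr k \<beta>) v" for v
    unfolding incr_def by (rule mon_act_step) (use assms D_D in auto)
  let ?a = "\<alpha>(k := \<alpha> k - 1)"
  have eq: "D k (vec x) = vec (incr_snd k x) +
      scale (of_nat (\<alpha> k)) (mon_act n X ?a (mon_act n D \<beta> (f i)))"
    using assms(2) by (simp add: x D_mon_act step)
  show ?thesis
  proof (cases "\<alpha> k = 0")
    case True
    then show ?thesis using eq by (intro bexI[of _ 0]) (simp_all add: span_zero)
  next
    case False
    \<comment> \<open>The lowered \<open>\<alpha>\<close> has sum r - 1 and \<open>\<beta>\<close>
      has sum s; one unit of slack in each brings the term to bidegree (r, s + 1) without changing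
      its vector.\<close>
    let ?y = "((incr n ?a, incr n \<beta>), i)"
    have "mon_act n X (incr n ?a) = mon_act n X ?a" "mon_act n D (incr n \<beta>) = mon_act n D \<beta>"
      by (rule mon_act_cong, simp add: incr_def)+
    then have vy: "vec ?y = mon_act n X ?a (mon_act n D \<beta> (f i))" by simp
    have sums: "(\<Sum>j\<le>n. ?a j) + 1 = (\<Sum>j\<le>n. \<alpha> j)" "(\<Sum>j<n. ?a j) + 1 = (\<Sum>j<n. \<alpha> j)"
      using sum_fun_upd[of "{..n}" \<alpha> k "\<alpha> k - 1"] sum_fun_upd[of "{..<n}" \<alpha> k "\<alpha> k - 1"]
        False assms(2) by simp_all
    have "?a \<in> comps n (r - 1)" "r \<noteq> 0"
      using assms sums(1) by (auto simp: x comps_def)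
    then have "?y \<in> indices n m r (Suc s)"
      using assms(1) incr_in_comps[of ?a n "r - 1" n] incr_in_comps[of \<beta> n s n] by (simp add: x)
    moreover have "(?y, incr_snd k x) \<in> index_less n"
      using sums(2) assms(2) by (simp add: x index_less_def sum_incr)
    ultimately have "vec ?y \<in> span (vec ` lower r (Suc s) (incr_snd k x))"
      by (intro span_base imageI) simp
    then have "scale (of_nat (\<alpha> k)) (vec ?y) \<in> span (vec ` lower r (Suc s) (incr_snd k x))"
      by (rule span_scale)
    then show ?thesis unfolding vy using eq by (rule rev_bexI)
  qed
qed

text \<open>The x-generators stand on the left, so \<open>X k\<close> sends monomial vectors exactly
  to monomial vectors and carries a relation led by \<open>x\<close> to one led by its increment.
  For \<open>k = n\<close> the map is the identity and only the indices move.\<close>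

lemma reducible_incr_fst:
  assumes "reducible r s x" "k \<le> n"
  shows "reducible (Suc r) s (incr_fst k x)"
proof -
  define L where "L = (if k < n then X k else (\<lambda>v. v))"
  have lin: "module_hom scale scale L"
    using linear_X[of k] module_hom_ident by (auto simp: L_def linear_iff_module_hom)
  have vec: "vec (incr_fst k y) = L (vec y)" for y
    by (simp add: L_def vec_incr_fst)
  have "vec (incr_fst k x) \<in> L ` span (vec ` lower r s x)"
    using assms(1) by (simp add: vec reducible_def)
  also have "\<dots> = span (L ` vec ` lower r s x)"
    using module_hom.span_image[OF lin] by simp
  also have "\<dots> \<subseteq> span (vec ` lower (Suc r) s (incr_fst k x))"
  proof (unfold image_image, rule span_mono, rule image_subsetI)
    fix y assume "y \<in> lower r s x"
    then have "incr_fst k y \<in> lower (Suc r) s (incr_fst k x)"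
      using incr_fst_in_indices[OF _ assms(2)] by (simp add: index_less_incr_fst)
    then have "vec (incr_fst k y) \<in> vec ` lower (Suc r) s (incr_fst k x)" by (rule imageI)
    then show "L (vec y) \<in> vec ` lower (Suc r) s (incr_fst k x)" by (simp only: vec)
  qed
  finally show ?thesis by (simp add: reducible_def)
qed

lemma lower_trans: "y \<in> lower r s x \<Longrightarrow> lower r s y \<subseteq> lower r s x"
  using transD[OF trans_index_less] by blast

text \<open>Applying \<open>D k\<close> to the relation adds correction terms. The correction of a
  smaller \<open>y\<close> lies below the incremented \<open>y\<close>, hence below the incremented
  \<open>x\<close>; the correction of \<open>x\<close> itself is subtracted at the end. For
  \<open>k = n\<close> no vector changes.\<close>

lemma reducible_incr_snd:
  assumes "reducible r s x" "x \<in> indices n m r s" "k \<le> n"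
  shows "reducible r (Suc s) (incr_snd k x)"
proof (cases "k < n")
  case True
  let ?S = "span (vec ` lower r (Suc s) (incr_snd k x))"
  have lin: "module_hom scale scale (D k)"
    using linear_D[OF True] by (simp add: linear_iff_module_hom)
  have "D k (vec x) \<in> D k ` span (vec ` lower r s x)"
    using assms(1) by (simp add: reducible_def)
  also have "\<dots> = span (D k ` vec ` lower r s x)"
    using module_hom.span_image[OF lin] by simp
  also have "\<dots> \<subseteq> ?S"
  proof (unfold image_image, rule span_minimal, rule image_subsetI)
    fix y assume y: "y \<in> lower r s x"
    then have z: "incr_snd k y \<in> lower r (Suc s) (incr_snd k x)"
      using incr_snd_in_indices[OF _ assms(3)] by (simp add: index_less_incr_snd)
    obtain u where u: "u \<in> span (vec ` lower r (Suc s) (incr_snd k y))"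
        "D k (vec y) = vec (incr_snd k y) + u"
      using D_vec[of y r s k] y True by blast
    have "u \<in> ?S" using u(1) span_mono[OF image_mono[OF lower_trans[OF z]]] by blast
    moreover have "vec (incr_snd k y) \<in> ?S" using z by (intro span_base imageI)
    ultimately show "D k (vec y) \<in> ?S" by (simp add: u(2) span_add)
  qed simp
  finally have Dx: "D k (vec x) \<in> ?S" .
  obtain u where u: "u \<in> ?S" "D k (vec x) = vec (incr_snd k x) + u"
    using D_vec[OF assms(2) True] by blast
  have "D k (vec x) - u \<in> ?S"
    using Dx u(1) by (rule span_diff)
  then show ?thesis by (simp only: u(2) reducible_def add_diff_cancel_right')
next
  case False
  then have k: "k = n" using assms(3) by simp
  have "vec ` lower r s x \<subseteq> vec ` lower r (Suc s) (incr_snd n x)"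
  proof (rule image_subsetI)
    fix y assume "y \<in> lower r s x"
    then have "incr_snd n y \<in> lower r (Suc s) (incr_snd n x)"
      using incr_snd_in_indices[OF _ order_refl] by (simp add: index_less_incr_snd)
    then have "vec (incr_snd n y) \<in> vec ` lower r (Suc s) (incr_snd n x)" by (rule imageI)
    then show "vec y \<in> vec ` lower r (Suc s) (incr_snd n x)" by (simp only: vec_incr_snd_last)
  qed
  then show ?thesis
    using assms(1) span_mono[THEN subsetD] by (simp only: reducible_def k vec_incr_snd_last)
qed

text \<open>The dimension is the number of irreducible indices. For each generator these are all
  pairs of exponent vectors minus the reducible ones, and the latter form an up-closed set.\<close>

lemma eventually_numeric_dim_bifilt:
  "eventually_numeric n (\<lambda>r s. int (dim (bifilt scale n X D m f r s)))"
proof -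
  \<comment> \<open>The bidegree is recovered from the coordinate sums, which turns the conditions
    for varying r and s into one predicate on pairs of vectors, as the counting lemma
    requires.\<close>
  define P where "P i = (\<lambda>(\<alpha>, \<beta>). reducible (\<Sum>k\<le>n. \<alpha> k) (\<Sum>k\<le>n. \<beta> k) ((\<alpha>, \<beta>), i))" for i
  let ?A = "\<lambda>r s. comps n r \<times> comps n s"
  have P: "P i x \<longleftrightarrow> reducible r s (x, i)" if "x \<in> ?A r s" for i x r s
    using that by (auto simp: P_def comps_def)
  have fin: "finite (?A r s)" for r s using finite_comps by blast
  have num: "eventually_numeric n (\<lambda>r s. int (card {x \<in> ?A r s. P i x}))" if i: "i < m" for i
  proof (rule eventually_numeric_card_upset)
    fix \<alpha> \<beta> k assume a: "\<alpha> \<in> exponents n" "\<beta> \<in> exponents n" "k \<le> n" "P i (\<alpha>, \<beta>)"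
    define r s where "r = (\<Sum>k\<le>n. \<alpha> k)" and "s = (\<Sum>k\<le>n. \<beta> k)"
    have mem: "\<alpha> \<in> comps n r" "\<beta> \<in> comps n s" using a by (auto simp: comps_def r_def s_def)
    have red: "reducible r s ((\<alpha>, \<beta>), i)" using P[of "(\<alpha>, \<beta>)"] mem a by simp
    have "reducible (Suc r) s ((incr k \<alpha>, \<beta>), i)"
      using reducible_incr_fst[OF red a(3)] by simp
    then have "P i (incr k \<alpha>, \<beta>)" using P incr_in_comps[OF mem(1) a(3)] mem(2) by auto
    then show "P i (\<alpha>(k := Suc (\<alpha> k)), \<beta>)" by (simp add: incr_def)
    have "reducible r (Suc s) ((\<alpha>, incr k \<beta>), i)"
      using reducible_incr_snd[OF red _ a(3)] mem i by simp
    then have "P i (\<alpha>, incr k \<beta>)" using P incr_in_comps[OF mem(2) a(3)] mem(1) by auto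
    then show "P i (\<alpha>, \<beta>(k := Suc (\<beta> k)))" by (simp add: incr_def)
  qed
  \<comment> \<open>The set of all pairs is trivially up-closed, so the same counting lemma applies
    to it.\<close>
  have all: "eventually_numeric n (\<lambda>r s. int (card (?A r s)))"
    using eventually_numeric_card_upset[of n "\<lambda>_. True"] by simp
  have "int (dim (bifilt scale n X D m f r s)) =
      (\<Sum>i<m. int (card (?A r s)) - int (card {x \<in> ?A r s. P i x}))" for r s
  proof -
    have "dim (bifilt scale n X D m f r s) = card {x \<in> indices n m r s. \<not> reducible r s x}"
      unfolding bifilt_eq_span_vec reducible_def
      by (intro dim_eq_card_not_in_span_smaller trans_index_less irrefl_index_less
          total_index_less finite_cartesian_product finite_comps finite_lessThan)
    also have "{x \<in> indices n m r s. \<not> reducible r s x} =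
        (\<Union>i\<in>{..<m}. (\<lambda>x. (x, i)) ` {x \<in> ?A r s. \<not> P i x})"
      using P by auto
    also have "card \<dots> = (\<Sum>i<m. card {x \<in> ?A r s. \<not> P i x})"
      using fin by (subst card_UN_disjoint) (auto simp: card_image inj_on_def)
    finally have "int (dim (bifilt scale n X D m f r s)) =
        (\<Sum>i<m. int (card {x \<in> ?A r s. \<not> P i x}))" by simp
    moreover have "int (card {x \<in> ?A r s. \<not> P i x}) =
        int (card (?A r s)) - int (card {x \<in> ?A r s. P i x})" for i
    proof -
      have "?A r s = {x \<in> ?A r s. \<not> P i x} \<union> {x \<in> ?A r s. P i x}" by blast
      moreover have "card ({x \<in> ?A r s. \<not> P i x} \<union> {x \<in> ?A r s. P i x}) =
          card {x \<in> ?A r s. \<not> P i x} + card {x \<in> ?A r s. P i x}"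
        using fin by (intro card_Un_disjoint) auto
      ultimately show ?thesis by simp
    qed
    ultimately show ?thesis by simp
  qed
  moreover have "eventually_numeric n
      (\<lambda>r s. \<Sum>i<m. int (card (?A r s)) - int (card {x \<in> ?A r s. P i x}))"
    by (intro eventually_numeric_sum eventually_numeric_diff all num) simp
  ultimately show ?thesis by simp
qed

end

theorem theorem5p4:
  fixes scale :: "'k::field_char_0 \<Rightarrow> 'v::ab_group_add \<Rightarrow> 'v"
    and n m :: nat and X D :: "nat \<Rightarrow> 'v \<Rightarrow> 'v" and f :: "nat \<Rightarrow> 'v"
  assumes "weyl_module scale n X D"
    and "weyl_generates scale n X D m f"
  shows "\<exists>a :: nat \<Rightarrow> nat \<Rightarrow> int. \<exists>r0 s0. \<forall>r\<ge>r0. \<forall>s\<ge>s0.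
           int (Vector_Spaces.vector_space.dim scale (bifilt scale n X D m f r s)) =
           (\<Sum>i\<le>n. \<Sum>j\<le>n. a i j * int ((r + i) choose i) * int ((s + j) choose j))"
proof -
  interpret weyl_module_family scale n m X D f
    by unfold_locales (rule assms(1))
  show ?thesis
    using eventually_numeric_dim_bifilt unfolding eventually_numeric_def .
qed

end
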